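(* Let $n,k$ be positive integers with $n\ge(3+\ln 4)\,124k$. Set $\delta_{\min,n,k}=4e^{3-n/(124k)}$ and $L_*=4\sqrt{2(1+2\ln 2)(1+62\ln 3)}\,e^{5/2}$. Then there exists a multiple-$\delta$ $L_*$-sub-Gaussian estimator for $(\mathcal{P}_{2,k\text{-reg}},n,\delta_{\min,n,k})$.
   Context: $\mathcal{P}_2$ is the class of all probability distributions on $\mathbb{R}$ with finite second moment; $\mu_P,\sigma_P^2$ denote the mean and variance of $P\in\mathcal{P}_2$. For $P\in\mathcal{P}_2$ and a positive integer $j$, let $X_1,\dots,X_j$ be i.i.d. with distribution $P$ and define $p_-(P,j)=\mathbb{P}\left(\sum_{i=1}^jX_i\le j\mu_P\right)$ and $p_+(P,j)=\mathbb{P}\left(\sum_{i=1}^jX_i\ge j\mu_P\right)$. The $k$-regular class is $\mathcal{P}_{2,k\text{-reg}}=\{P\in\mathcal{P}_2:\ \forall j\ge k,\ \min(p_+(P,j),p_-(P,j))\ge 1/3\}$. Given a family $\mathcal{P}\subset\mathcal{P}_2$, $L>0$ and $\delta_{\min}\in(0,1)$, a multiple-$\delta$ $L$-sub-Gaussian estimator for $(\mathcal{P},n,\delta_{\min})$ is a measurable map $\widehat{E}_n:\mathbb{R}^n\to\mathbb{R}$ such that for all $\delta\in[\delta_{\min},1)$, $P\in\mathcal{P}$ and i.i.d. samples $X_1^n=(X_1,\dots,X_n)$ from $P$, $\mathbb{P}\left(|\widehat{E}_n(X_1^n)-\mu_P|>L\,\sigma_P\sqrt{\frac{1+\ln(1/\delta)}{n}}\right)\le\delta$.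 *)

theory Defs
  imports "HOL-Probability.Probability"
begin

text \<open>
  A probability distribution on the real line is a measure satisfying the library predicate
  \<^const>\<open>real_distribution\<close>, i.e. a probability measure on the Borel sets.
\<close>

definition mean :: "real measure \<Rightarrow> real" where
  "mean P = (LINT x|P. x)"

definition variance_of :: "real measure \<Rightarrow> real" where
  "variance_of P = (LINT x|P. (x - mean P)\<^sup>2)"

definition std_dev :: "real measure \<Rightarrow> real" where
  "std_dev P = sqrt (variance_of P)"

definition P2 :: "real measure set" where
  "P2 = {P. real_distribution P \<and> integrable P (\<lambda>x. x\<^sup>2)}"

text \<open>
  The law of an i.i.d. sample of size \<open>n\<close> is the product measure of \<open>n\<close> copies of \<open>P\<close>; sample
  points are functions on the index set \<open>{..<n}\<close>. The lemma \<open>prob_iid_sample\<close> below shows that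
  probabilities computed there are those of i.i.d. variables on an arbitrary probability space.
\<close>

definition iid_sample :: "nat \<Rightarrow> real measure \<Rightarrow> (nat \<Rightarrow> real) measure" where
  "iid_sample n P = (\<Pi>\<^sub>M i\<in>{..<n}. P)"

lemma (in prob_space) prob_iid_sample:
  fixes X :: "nat \<Rightarrow> 'a \<Rightarrow> real"
  assumes "n > 0"
    and indep: "indep_vars (\<lambda>_. borel) X {..<n}"
    and law: "\<And>i. i < n \<Longrightarrow> distr M borel (X i) = P"
    and A: "A \<in> sets (\<Pi>\<^sub>M i\<in>{..<n}. borel)"
  shows "prob {\<omega> \<in> space M. (\<lambda>i\<in>{..<n}. X i \<omega>) \<in> A} = measure (iid_sample n P) A"
proof -
  have rv: "random_variable borel (X i)" if "i \<in> {..<n}" for i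
    using indep that unfolding indep_vars_def by auto
  have "distr M (\<Pi>\<^sub>M i\<in>{..<n}. borel) (\<lambda>\<omega>. \<lambda>i\<in>{..<n}. X i \<omega>)
      = (\<Pi>\<^sub>M i\<in>{..<n}. distr M borel (X i))"
    using indep_vars_iff_distr_eq_PiM'[where I = "{..<n}" and M' = "\<lambda>_. borel" and X = X] indep rv \<open>n > 0\<close>
    by (simp add: lessThan_empty_iff)
  also have "\<dots> = iid_sample n P"
    unfolding iid_sample_def using law by (intro PiM_cong) auto
  finally have D: "iid_sample n P
      = distr M (\<Pi>\<^sub>M i\<in>{..<n}. borel) (\<lambda>\<omega>. \<lambda>i\<in>{..<n}. X i \<omega>)" ..
  have "(\<lambda>\<omega>. \<lambda>i\<in>{..<n}. X i \<omega>) \<in> measurable M (\<Pi>\<^sub>M i\<in>{..<n}. borel)"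
    using rv by (intro measurable_restrict) auto
  then show ?thesis
    unfolding D using A by (simp add: measure_distr vimage_def Int_def conj_commute)
qed

definition p_minus :: "real measure \<Rightarrow> nat \<Rightarrow> real" where
  "p_minus P j = measure (iid_sample j P)
     {x \<in> space (iid_sample j P). (\<Sum>i<j. x i) \<le> real j * mean P}"

definition p_plus :: "real measure \<Rightarrow> nat \<Rightarrow> real" where
  "p_plus P j = measure (iid_sample j P)
     {x \<in> space (iid_sample j P). (\<Sum>i<j. x i) \<ge> real j * mean P}"

definition P2_reg :: "nat \<Rightarrow> real measure set" where
  "P2_reg k = {P \<in> P2. \<forall>j\<ge>k. min (p_plus P j) (p_minus P j) \<ge> 1 / 3}"

text \<open>
  The estimator is a Borel map on \<open>n\<close>-tuples of reals. It is chosen before, hence independently of,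
  \<open>\<delta>\<close> and \<open>P\<close>.
\<close>

definition multiple_delta_subgaussian_estimator ::
    "real \<Rightarrow> real measure set \<Rightarrow> nat \<Rightarrow> real \<Rightarrow> ((nat \<Rightarrow> real) \<Rightarrow> real) \<Rightarrow> bool" where
  "multiple_delta_subgaussian_estimator L \<P> n \<delta>min E \<longleftrightarrow>
     E \<in> borel_measurable (\<Pi>\<^sub>M i\<in>{..<n}. borel) \<and>
     (\<forall>\<delta>\<in>{\<delta>min..<1}. \<forall>P\<in>\<P>.
        measure (iid_sample n P)
          {x \<in> space (iid_sample n P).
             \<bar>E x - mean P\<bar> > L * std_dev P * sqrt ((1 + ln (1 / \<delta>)) / real n)} \<le> \<delta>)"

end

theory Submission
  imports Defs
begin

text \<open>
  For every number of blocks \<open>b\<close> the sample is cut into \<open>b\<close> blocks of equal length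
  \<open>m = n div b\<close>, and \<open>I\<^sub>b\<close> is the interval between the lower and the upper quartile of the
  \<open>b\<close> block means. As soon as \<open>m \<ge> k\<close>, regularity says that each block mean lies on either given
  side of \<open>\<mu>\<close> with probability at least \<open>1/3\<close>. The interval misses \<open>\<mu>\<close> only if at most a quarter of
  these independent block means lie on one of the sides; the gap \<open>1/3 - 1/4 = 1/12\<close> and Hoeffding's
  inequality bound this probability by \<open>2 exp (-b/72)\<close> (\<open>miss_prob\<close>). By
  Chebyshev's inequality a block mean is farther than
  \<open>w = \<sigma> sqrt (6/m)\<close> from \<open>\<mu>\<close> with probability at most \<open>1/6 = 1/4 - 1/12\<close>, so
  Hoeffding's inequality again gives \<open>I\<^sub>b \<subseteq> [\<mu> - w, \<mu> + w]\<close> up to probability \<open>exp (-b/72)\<close>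
  (\<open>wide_prob\<close>).

  The interval \<open>I\<^sub>b\<close> thus serves a confidence level \<open>\<delta>\<close> with \<open>b\<close> of the order of \<open>1 + ln (1/\<delta>)\<close>.
  To serve all levels with one estimator, let \<open>B = n div k\<close> be the largest admissible number of
  blocks and follow Lepski's method: take a point of \<open>I\<^sub>b \<inter> \<dots> \<inter> I\<^sub>B\<close> for the smallest \<open>b\<close> for which
  this intersection is nonempty. Whenever \<open>\<mu> \<in> I\<^sub>j\<close> for all \<open>j \<in> {b..B}\<close>, this
  smallest index is at most \<open>b\<close>, hence the selected point lies in \<open>I\<^sub>b\<close> too
  (\<open>lepski_select_in_interval\<close>), and its error is at most \<open>w\<close> if also \<open>I\<^sub>b \<subseteq> [\<mu> - w, \<mu> + w]\<close>.

  Given \<open>\<delta>\<close>, put \<open>b = \<lfloor>124 (ln (1/\<delta>) + 3 + ln 4)\<rfloor>\<close>; the lower bound on \<open>\<delta>\<close> says exactly that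
  \<open>124 (ln (1/\<delta>) + 3 + ln 4) \<le> n/k\<close>, so \<open>b \<le> B\<close>. Because \<open>124 > 72\<close>, the failure
  probabilities over all \<open>j \<ge> b\<close> form a geometric series with sum at most \<open>147 exp (-b/72) \<le> \<delta>\<close>,
  and \<open>w\<close> is within the prescribed multiple of \<open>\<sigma> sqrt ((1 + ln (1/\<delta>)) / n)\<close>.
\<close>

section \<open>Counting successes among independent trials\<close>

text \<open>
  Hoeffding's inequality for the indicators of \<open>Y c \<in> S\<close>. Only a lower bound \<open>p\<close> on their
  expectations is available, which is enough because it only lowers the threshold.
\<close>

lemma (in prob_space) few_hits_prob:
  fixes Y :: "nat \<Rightarrow> 'a \<Rightarrow> real"
  assumes indep: "indep_vars (\<lambda>_. borel) Y {..<b}"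
    and "b > 0" and S [measurable]: "S \<in> sets borel" and "\<epsilon> \<ge> 0"
    and p: "\<And>c. c < b \<Longrightarrow> p \<le> prob {\<omega> \<in> space M. Y c \<omega> \<in> S}"
  shows "prob {\<omega> \<in> space M. real (card {c \<in> {..<b}. Y c \<omega> \<in> S}) \<le> (p - \<epsilon>) * real b}
           \<le> exp (- 2 * \<epsilon>\<^sup>2 * real b)"
proof -
  define Z where "Z c \<omega> = (indicator S (Y c \<omega>) :: real)" for c \<omega>
  have rv: "random_variable borel (Y c)" if "c < b" for c
    using indep that unfolding indep_vars_def by auto
  interpret Hoeffding_ineq M "{..<b}" Z "\<lambda>_. 0" "\<lambda>_. 1" "\<Sum>c<b. expectation (Z c)"
  proof unfold_locales
    show "indep_vars (\<lambda>_. borel) Z {..<b}"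
      unfolding Z_def by (rule indep_vars_compose2[OF indep]) simp
  qed (auto simp: Z_def indicator_def)
  have mean_ge: "p * real b \<le> (\<Sum>c<b. expectation (Z c))"
  proof -
    have "p \<le> expectation (Z c)" if "c < b" for c
    proof -
      note rv[OF that, measurable]
      have "expectation (Z c) = expectation (indicator {\<omega> \<in> space M. Y c \<omega> \<in> S})"
        unfolding Z_def by (intro Bochner_Integration.integral_cong) (auto simp: indicator_def)
      also have "\<dots> = prob {\<omega> \<in> space M. Y c \<omega> \<in> S}"
        by (simp add: Int_absorb2 subsetI)
      finally show ?thesis
        using p[OF that] by simp
    qed
    then show ?thesis
      using sum_mono[of "{..<b}" "\<lambda>_. p" "\<lambda>c. expectation (Z c)"] by (simp add: mult.commute)
  qed
  have sum_Z: "(\<Sum>c<b. Z c \<omega>) = real (card {c \<in> {..<b}. Y c \<omega> \<in> S})" for \<omega>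
    unfolding Z_def indicator_def by (simp add: sum.If_cases Int_def)
  have "prob {\<omega> \<in> space M. real (card {c \<in> {..<b}. Y c \<omega> \<in> S}) \<le> (p - \<epsilon>) * real b}
      \<le> prob {\<omega> \<in> space M. (\<Sum>c<b. Z c \<omega>) \<le> (\<Sum>c<b. expectation (Z c)) - \<epsilon> * real b}"
  proof (rule finite_measure_mono)
    show "{\<omega> \<in> space M. real (card {c \<in> {..<b}. Y c \<omega> \<in> S}) \<le> (p - \<epsilon>) * real b}
        \<subseteq> {\<omega> \<in> space M. (\<Sum>c<b. Z c \<omega>) \<le> (\<Sum>c<b. expectation (Z c)) - \<epsilon> * real b}"
      using mean_ge by (auto simp: sum_Z left_diff_distrib)
  qed (use random_variable in measurable)
  also have "\<dots> \<le> exp (- 2 * (\<epsilon> * real b)\<^sup>2 / (\<Sum>c<b. (1 - 0)\<^sup>2))"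
    using \<open>b > 0\<close> \<open>\<epsilon> \<ge> 0\<close> by (intro Hoeffding_ineq_le) auto
  also have "- 2 * (\<epsilon> * real b)\<^sup>2 / (\<Sum>c<b. (1 - 0)\<^sup>2) = - 2 * \<epsilon>\<^sup>2 * real b"
    using \<open>b > 0\<close> by (simp add: power2_eq_square)
  finally show ?thesis .
qed

text \<open>Many hits of \<open>S\<close> are few hits of its complement.\<close>

lemma (in prob_space) many_hits_prob:
  fixes Y :: "nat \<Rightarrow> 'a \<Rightarrow> real"
  assumes indep: "indep_vars (\<lambda>_. borel) Y {..<b}"
    and "b > 0" and S [measurable]: "S \<in> sets borel" and "\<epsilon> \<ge> 0"
    and p: "\<And>c. c < b \<Longrightarrow> prob {\<omega> \<in> space M. Y c \<omega> \<in> S} \<le> p"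
  shows "prob {\<omega> \<in> space M. real (card {c \<in> {..<b}. Y c \<omega> \<in> S}) \<ge> (p + \<epsilon>) * real b}
           \<le> exp (- 2 * \<epsilon>\<^sup>2 * real b)"
proof -
  have card_compl: "real (card {c \<in> {..<b}. Y c \<omega> \<in> - S})
      = real b - real (card {c \<in> {..<b}. Y c \<omega> \<in> S})" for \<omega>
  proof -
    have "{c \<in> {..<b}. Y c \<omega> \<in> - S} = {..<b} - {c \<in> {..<b}. Y c \<omega> \<in> S}"
      by auto
    moreover have "card {c \<in> {..<b}. Y c \<omega> \<in> S} \<le> card {..<b}"
      by (rule card_mono) auto
    moreover have "card ({..<b} - {c \<in> {..<b}. Y c \<omega> \<in> S})
        = card {..<b} - card {c \<in> {..<b}. Y c \<omega> \<in> S}"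
      by (rule card_Diff_subset) auto
    ultimately show ?thesis
      by (simp only: card_lessThan of_nat_diff)
  qed
  have "1 - p \<le> prob {\<omega> \<in> space M. Y c \<omega> \<in> - S}" if "c < b" for c
  proof -
    have [measurable]: "random_variable borel (Y c)"
      using indep that unfolding indep_vars_def by auto
    have "prob {\<omega> \<in> space M. Y c \<omega> \<in> - S} = 1 - prob {\<omega> \<in> space M. Y c \<omega> \<in> S}"
      using prob_neg[of "\<lambda>\<omega>. Y c \<omega> \<in> S"] by simp
    then show ?thesis
      using p[OF that] by simp
  qed
  from few_hits_prob[OF indep \<open>b > 0\<close> _ \<open>\<epsilon> \<ge> 0\<close> this] show ?thesis
    unfolding card_compl by (simp add: algebra_simps)
qed

section \<open>Block means\<close>

definition block_mean :: "nat \<Rightarrow> nat \<Rightarrow> (nat \<Rightarrow> real) \<Rightarrow> real" where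
  "block_mean m c x = (\<Sum>i<m. x (c * m + i)) / real m"

lemma block_index_less:
  fixes c b m n i :: nat
  assumes "c < b" "i < m" "b * m \<le> n"
  shows "c * m + i < n"
proof -
  have "c * m + i < (c + 1) * m"
    using assms by simp
  also have "\<dots> \<le> b * m"
    using assms by (intro mult_right_mono) auto
  finally show ?thesis
    using assms by simp
qed

lemma prob_space_iid_sample:
  assumes "real_distribution P"
  shows "prob_space (iid_sample n P)"
  unfolding iid_sample_def using assms by (intro prob_space_PiM) (simp add: real_distribution_def)

lemma sets_iid_sample:
  assumes "real_distribution P"
  shows "sets (iid_sample n P) = sets (\<Pi>\<^sub>M i\<in>{..<n}. borel)"
  unfolding iid_sample_def using assms
  by (intro sets_PiM_cong) (auto simp: real_distribution_def real_distribution_axioms_def)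

lemma measurable_iid_sample:
  assumes "real_distribution P" "f \<in> borel_measurable (\<Pi>\<^sub>M i\<in>{..<n}. borel)"
  shows "f \<in> borel_measurable (iid_sample n P)"
  using assms(2) measurable_cong_sets[OF sets_iid_sample[OF assms(1)] refl] by blast

lemma measurable_block_mean:
  assumes "c < b" "b * m \<le> n"
  shows "block_mean m c \<in> borel_measurable (\<Pi>\<^sub>M i\<in>{..<n}. borel)"
  unfolding block_mean_def using block_index_less[OF assms(1) _ assms(2)]
  by (intro borel_measurable_divide borel_measurable_sum measurable_component_singleton) auto

lemma coordinate_law:
  assumes "real_distribution P" "i < n"
  shows "distr (iid_sample n P) borel (\<lambda>x. x i) = P"
proof -
  have "distr (iid_sample n P) borel (\<lambda>x. x i) = distr (iid_sample n P) P (\<lambda>x. x i)"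
    using assms by (intro distr_cong) (auto simp: real_distribution_def real_distribution_axioms_def)
  also have "\<dots> = P"
    unfolding iid_sample_def using assms
    by (intro distr_PiM_component) (auto simp: real_distribution_def)
  finally show ?thesis .
qed

text \<open>
  Independence is equivalent to the joint law being the product of the marginal laws, and here the
  joint law is that product by definition.
\<close>

lemma coordinates_indep:
  assumes P: "real_distribution P"
  shows "prob_space.indep_vars (iid_sample n P) (\<lambda>_. borel) (\<lambda>i x. x i) {..<n}"
proof -
  interpret prob_space "iid_sample n P"
    using P by (rule prob_space_iid_sample)
  show ?thesis
  proof (cases "n = 0")
    case True
    then show ?thesis
      unfolding indep_vars_def indep_sets_def by simp
  next
    case False
    have rv: "random_variable borel (\<lambda>x. x i)" if "i \<in> {..<n}" for i
      using that by (intro measurable_iid_sample[OF P] measurable_component_singleton)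
    have "distr (iid_sample n P) (\<Pi>\<^sub>M i\<in>{..<n}. borel) (\<lambda>x. \<lambda>i\<in>{..<n}. x i)
        = distr (iid_sample n P) (iid_sample n P) (\<lambda>x. x)"
    proof (intro distr_cong refl)
      show "sets (\<Pi>\<^sub>M i\<in>{..<n}. borel) = events"
        by (simp add: sets_iid_sample[OF P])
    qed (auto simp: iid_sample_def space_PiM)
    also have "\<dots> = iid_sample n P"
      by simp
    also have "\<dots> = (\<Pi>\<^sub>M i\<in>{..<n}. distr (iid_sample n P) borel (\<lambda>x. x i))"
      by (subst (1) iid_sample_def) (intro PiM_cong, auto simp: coordinate_law[OF P])
    finally show ?thesis
      using indep_vars_iff_distr_eq_PiM'[where I = "{..<n}" and M' = "\<lambda>_. borel" and X = "\<lambda>i x. x i"]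
        rv False by (simp add: lessThan_empty_iff)
  qed
qed

text \<open>Distinct blocks use disjoint sets of coordinates.\<close>

lemma block_means_indep:
  assumes P: "real_distribution P" and "b * m \<le> n"
  shows "prob_space.indep_vars (iid_sample n P) (\<lambda>_. borel) (block_mean m) {..<b}"
proof -
  interpret prob_space "iid_sample n P"
    using P by (rule prob_space_iid_sample)
  define K where "K c = (\<lambda>i. c * m + i) ` {..<m}" for c
  have "disjoint_family_on K {..<b}"
  proof -
    have "(c * m + i) div m = c" if "i < m" for c i
      using that by simp
    then show ?thesis
      unfolding disjoint_family_on_def K_def by (auto, metis)
  qed
  moreover have "K c \<subseteq> {..<n}" if "c \<in> {..<b}" for c
    using that block_index_less[of c b _ m n] assms(2) unfolding K_def by auto
  ultimately have "indep_vars (\<lambda>c. \<Pi>\<^sub>M i\<in>K c. borel) (\<lambda>c x. \<lambda>i\<in>K c. x i) {..<b}"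
    by (intro indep_vars_restrict[OF coordinates_indep[OF P]])
  then have "indep_vars (\<lambda>_. borel) (\<lambda>c x. block_mean m c (\<lambda>i\<in>K c. x i)) {..<b}"
  proof (rule indep_vars_compose2)
    fix c
    show "block_mean m c \<in> borel_measurable (\<Pi>\<^sub>M i\<in>K c. borel)"
      unfolding block_mean_def K_def
      by (intro borel_measurable_divide borel_measurable_sum measurable_component_singleton) auto
  qed
  moreover have "(\<lambda>c x. block_mean m c (\<lambda>i\<in>K c. x i)) = block_mean m"
    unfolding block_mean_def K_def by (auto simp: fun_eq_iff intro!: sum.cong)
  ultimately show ?thesis
    by simp
qed

text \<open>
  Reindexing shows that block \<open>c\<close> of a sample of size \<open>n\<close> is itself an i.i.d. sample of size \<open>m\<close>. This is how
  the regularity condition, which speaks of samples of size \<open>m\<close>, applies to the blocks.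
\<close>

lemma block_mean_prob:
  assumes P: "real_distribution P" and c: "c < b" and "b * m \<le> n" and [measurable]: "S \<in> sets borel"
  shows "measure (iid_sample n P) {x \<in> space (iid_sample n P). block_mean m c x \<in> S}
       = measure (iid_sample m P) {x \<in> space (iid_sample m P). block_mean m 0 x \<in> S}"
proof -
  let ?f = "\<lambda>x. \<lambda>i\<in>{..<m}. x (c * m + i)"
  have D: "iid_sample m P = distr (iid_sample n P) (iid_sample m P) ?f"
    unfolding iid_sample_def
    using distr_PiM_reindex[of "{..<n}" "\<lambda>_. P" "\<lambda>i. c * m + i" "{..<m}"] P
      block_index_less[OF c _ \<open>b * m \<le> n\<close>]
    by (auto simp: real_distribution_def inj_on_def)
  have f: "?f \<in> measurable (iid_sample n P) (iid_sample m P)"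
    unfolding iid_sample_def using block_index_less[OF c _ \<open>b * m \<le> n\<close>]
    by (intro measurable_restrict measurable_component_singleton) auto
  have [measurable]: "block_mean m 0 \<in> borel_measurable (iid_sample m P)"
    by (rule measurable_iid_sample[OF P measurable_block_mean[of 0 1]]) auto
  have "measure (iid_sample m P) {x \<in> space (iid_sample m P). block_mean m 0 x \<in> S}
      = measure (distr (iid_sample n P) (iid_sample m P) ?f)
          {x \<in> space (iid_sample m P). block_mean m 0 x \<in> S}"
    using D by simp
  also have "\<dots> = measure (iid_sample n P)
      (?f -` {x \<in> space (iid_sample m P). block_mean m 0 x \<in> S} \<inter> space (iid_sample n P))"
    by (rule measure_distr[OF f]) measurable
  also have "?f -` {x \<in> space (iid_sample m P). block_mean m 0 x \<in> S} \<inter> space (iid_sample n P)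
      = {x \<in> space (iid_sample n P). block_mean m c x \<in> S}"
    using measurable_space[OF f] by (auto simp: block_mean_def)
  finally show ?thesis ..
qed

section \<open>Deviation of one block mean\<close>

lemma P2_integrable:
  assumes "P \<in> P2"
  shows "real_distribution P" "integrable P (\<lambda>x. x)" "integrable P (\<lambda>x. (x - a)\<^sup>2)"
proof -
  show P: "real_distribution P"
    using assms by (simp add: P2_def)
  then interpret real_distribution P .
  have sq: "integrable P (\<lambda>x. x\<^sup>2)"
    using assms by (simp add: P2_def)
  show i: "integrable P (\<lambda>x. x)"
    by (rule square_integrable_imp_integrable[OF _ sq]) simp
  have "integrable P (\<lambda>x. x\<^sup>2 - 2 * a * x + a\<^sup>2)"
    using sq i by (intro Bochner_Integration.integrable_add Bochner_Integration.integrable_diff) auto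
  then show "integrable P (\<lambda>x. (x - a)\<^sup>2)"
    by (simp add: power2_diff algebra_simps)
qed

text \<open>
  Expand the square of the centred sum: by independence the mixed products have expectation \<open>0\<close>, and
  each of the \<open>m\<close> diagonal terms contributes the variance.
\<close>

lemma variance_sample_sum:
  fixes m :: nat
  assumes P2: "P \<in> P2"
  defines "S \<equiv> \<lambda>x. \<Sum>i<m. x i - mean P"
  shows "integrable (iid_sample m P) (\<lambda>x. (S x)\<^sup>2)"
    and "(LINT x|iid_sample m P. (S x)\<^sup>2) = real m * variance_of P"
proof -
  note P = P2_integrable[OF P2]
  interpret P: real_distribution P by (rule P)
  interpret prob_space "iid_sample m P"
    using P(1) by (rule prob_space_iid_sample)
  have coord: "(\<lambda>x. x i) \<in> borel_measurable (iid_sample m P)" if "i < m" for i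
    using that by (intro measurable_iid_sample[OF P(1)] measurable_component_singleton) auto
  have transfer: "integrable (iid_sample m P) (\<lambda>x. f (x i)) = integrable P f"
      "(LINT x|iid_sample m P. f (x i)) = (LINT x|P. f x)"
    if "i < m" "f \<in> borel_measurable borel" for i and f :: "real \<Rightarrow> real"
    using integrable_distr_eq[OF coord[OF that(1)] that(2)]
      integral_distr[OF coord[OF that(1)] that(2)]
    unfolding coordinate_law[OF P(1) that(1)] by simp_all
  let ?D = "\<lambda>i x. x i - mean P"
  have indep: "indep_vars (\<lambda>_. borel) ?D {..<m}"
    by (rule indep_vars_compose2[OF coordinates_indep[OF P(1)]]) simp
  have int_D: "integrable P (\<lambda>x. x - mean P)"
    using P(2) by simp
  have "(LINT x|P. x - mean P) = (LINT x|P. x) - (LINT x|P. mean P)"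
    using P(2) by (intro Bochner_Integration.integral_diff) auto
  also have "(LINT x|P. mean P) = mean P"
    using P.prob_space by simp
  finally have zero_D: "(LINT x|P. x - mean P) = 0"
    by (simp add: mean_def)
  have centred: "integrable (iid_sample m P) (?D i)" "expectation (?D i) = 0" if "i < m" for i
    using transfer[OF that, of "\<lambda>x. x - mean P"] int_D zero_D by simp_all
  have cov: "integrable (iid_sample m P) (\<lambda>x. ?D i x * ?D j x)"
      "expectation (\<lambda>x. ?D i x * ?D j x) = (if i = j then variance_of P else 0)"
    if "i < m" "j < m" for i j
  proof -
    have "integrable (iid_sample m P) (\<lambda>x. ?D i x * ?D j x) \<and>
      expectation (\<lambda>x. ?D i x * ?D j x) = (if i = j then variance_of P else 0)"
    proof (cases "i = j")
      case True
      then show ?thesis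
        using transfer[OF that(1), of "\<lambda>x. (x - mean P)\<^sup>2"] P(3)[of "mean P"]
        by (auto simp: power2_eq_square variance_of_def)
    next
      case False
      have ij: "indep_vars (\<lambda>_. borel) ?D {i, j}"
        using that by (intro indep_vars_subset[OF indep]) auto
      have int: "\<And>l. l \<in> {i, j} \<Longrightarrow> integrable (iid_sample m P) (?D l)"
        using centred that by auto
      show ?thesis
        using indep_vars_integrable[OF _ ij int] indep_vars_lebesgue_integral[OF _ ij int]
          False centred that by simp
    qed
    then show "integrable (iid_sample m P) (\<lambda>x. ?D i x * ?D j x)"
      "expectation (\<lambda>x. ?D i x * ?D j x) = (if i = j then variance_of P else 0)" by auto
  qed
  have sq: "(S x)\<^sup>2 = (\<Sum>i<m. \<Sum>j<m. ?D i x * ?D j x)" for x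
    unfolding S_def power2_eq_square by (rule sum_product)
  show "integrable (iid_sample m P) (\<lambda>x. (S x)\<^sup>2)"
    unfolding sq using cov by (intro Bochner_Integration.integrable_sum) auto
  have "(LINT x|iid_sample m P. (S x)\<^sup>2)
      = (\<Sum>i<m. \<Sum>j<m. expectation (\<lambda>x. ?D i x * ?D j x))"
    unfolding sq using cov
    by (subst Bochner_Integration.integral_sum, fastforce)
      (auto intro!: sum.cong Bochner_Integration.integral_sum)
  also have "\<dots> = (\<Sum>i<m. \<Sum>j<m. if i = j then variance_of P else 0)"
    using cov by (intro sum.cong) auto
  finally show "(LINT x|iid_sample m P. (S x)\<^sup>2) = real m * variance_of P"
    by simp
qed

text \<open>
  This is Chebyshev's inequality, with a strict inequality in the event so that it also covers
  degenerate distributions: for variance \<open>0\<close> the sample mean equals the mean almost surely.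
\<close>

lemma sample_mean_deviation:
  assumes P2: "P \<in> P2" and "m > 0" "a > 0"
  shows "measure (iid_sample m P) {x \<in> space (iid_sample m P).
      \<bar>block_mean m 0 x - mean P\<bar> > sqrt (a / real m) * std_dev P} \<le> 1 / a"
proof -
  note P = P2_integrable[OF P2]
  interpret prob_space "iid_sample m P"
    using P(1) by (rule prob_space_iid_sample)
  let ?S = "\<lambda>x. \<Sum>i<m. x i - mean P"
  have meas [measurable]: "?S \<in> borel_measurable (iid_sample m P)"
    by (intro measurable_iid_sample[OF P(1)] borel_measurable_sum borel_measurable_diff
        measurable_component_singleton) auto
  note var = variance_sample_sum[OF P2, of m]
  have var_nonneg: "variance_of P \<ge> 0"
    unfolding variance_of_def by (rule integral_nonneg_AE) simp
  have dev: "\<bar>block_mean m 0 x - mean P\<bar> > sqrt (a / real m) * std_dev P \<longleftrightarrow>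
      \<bar>?S x\<bar> > sqrt (a * real m) * std_dev P" for x
  proof -
    have "block_mean m 0 x - mean P = ?S x / real m"
      using \<open>m > 0\<close> by (simp add: block_mean_def sum_subtractf field_simps)
    moreover have "sqrt (a * real m) = real m * sqrt (a / real m)"
      using \<open>m > 0\<close> by (simp add: real_sqrt_mult real_sqrt_divide field_simps)
    moreover have "real m * (sqrt (a / real m) * std_dev P) < real m * \<bar>?S x / real m\<bar> \<longleftrightarrow>
        sqrt (a / real m) * std_dev P < \<bar>?S x / real m\<bar>"
      using \<open>m > 0\<close> by (intro mult_less_cancel_left_pos) simp
    ultimately show ?thesis
      using \<open>m > 0\<close> by (simp add: abs_divide mult.assoc)
  qed
  show ?thesis
  proof (cases "variance_of P = 0")
    case True
    then have "AE x in iid_sample m P. (?S x)\<^sup>2 = 0"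
      using var by (subst integral_nonneg_eq_0_iff_AE[symmetric]) auto
    then have "AE x in iid_sample m P. \<not> \<bar>?S x\<bar> > sqrt (a * real m) * std_dev P"
      by eventually_elim (simp add: True std_dev_def)
    then have "prob {x \<in> space (iid_sample m P). \<bar>?S x\<bar> > sqrt (a * real m) * std_dev P} = 0"
      by (subst prob_eq_0) auto
    then show ?thesis
      unfolding dev using \<open>a > 0\<close> by simp
  next
    case False
    let ?t = "sqrt (a * real m) * std_dev P"
    have t: "?t > 0"
      using False var_nonneg \<open>m > 0\<close> \<open>a > 0\<close> by (simp add: std_dev_def)
    have "prob {x \<in> space (iid_sample m P). \<bar>?S x\<bar> > ?t}
        \<le> prob {x \<in> space (iid_sample m P). \<bar>?S x\<bar> \<ge> ?t}"
      by (rule finite_measure_mono) auto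
    also have "\<dots> \<le> expectation (\<lambda>x. (?S x)\<^sup>2) / ?t\<^sup>2"
      by (rule second_moment_method[OF meas var(1) t])
    also have "\<dots> = 1 / a"
      unfolding var(2) using False var_nonneg \<open>m > 0\<close> \<open>a > 0\<close>
      by (simp add: power_mult_distrib std_dev_def)
    finally show ?thesis
      unfolding dev .
  qed
qed

section \<open>Order statistics\<close>

text \<open>
  These are the \<open>r\<close>-th smallest and the \<open>r\<close>-th largest of the values \<open>y 0, \<dots>, y (b - 1)\<close>. Written
  as a minimum of maxima over the index sets of size \<open>r\<close>, they need no sorting, and as finite minima and maxima they are
  visibly measurable functions of the values.
\<close>

definition lower_stat :: "nat \<Rightarrow> nat \<Rightarrow> (nat \<Rightarrow> real) \<Rightarrow> real" where
  "lower_stat r b y = Min ((\<lambda>T. Max (y ` T)) ` {T. T \<subseteq> {..<b} \<and> card T = r})"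

definition upper_stat :: "nat \<Rightarrow> nat \<Rightarrow> (nat \<Rightarrow> real) \<Rightarrow> real" where
  "upper_stat r b y = Max ((\<lambda>T. Min (y ` T)) ` {T. T \<subseteq> {..<b} \<and> card T = r})"

lemma finite_rank_sets: "finite {T. T \<subseteq> {..<b::nat} \<and> card T = r}"
  by (rule finite_subset[of _ "Pow {..<b}"]) auto

lemma rank_sets_nonempty: "r \<le> b \<Longrightarrow> {T. T \<subseteq> {..<b::nat} \<and> card T = r} \<noteq> {}"
  using obtain_subset_with_card_n[of r "{..<b}"] by fastforce

lemma lower_stat_le:
  assumes "0 < r" "r \<le> card {c \<in> {..<b}. y c \<le> t}"
  shows "lower_stat r b y \<le> t"
proof -
  obtain T where T: "T \<subseteq> {c \<in> {..<b}. y c \<le> t}" "card T = r" "finite T"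
    using obtain_subset_with_card_n[OF assms(2)] by blast
  have "lower_stat r b y \<le> Max (y ` T)"
    unfolding lower_stat_def using T finite_rank_sets by (intro Min_le) auto
  also have "\<dots> \<le> t"
    using T assms(1) by (subst Max_le_iff) auto
  finally show ?thesis .
qed

lemma upper_stat_ge:
  assumes "0 < r" "r \<le> card {c \<in> {..<b}. t \<le> y c}"
  shows "t \<le> upper_stat r b y"
proof -
  obtain T where T: "T \<subseteq> {c \<in> {..<b}. t \<le> y c}" "card T = r" "finite T"
    using obtain_subset_with_card_n[OF assms(2)] by blast
  have "t \<le> Min (y ` T)"
    using T assms(1) by (subst Min_ge_iff) auto
  also have "\<dots> \<le> upper_stat r b y"
    unfolding upper_stat_def using T finite_rank_sets by (intro Max_ge) auto
  finally show ?thesis .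
qed

lemma rank_set_meets_majority:
  fixes b :: nat
  assumes "card {c \<in> {..<b}. \<not> Q c} < r" "T \<subseteq> {..<b}" "card T = r"
  obtains c where "c \<in> T" "Q c" "finite T"
proof -
  have fin: "finite T"
    using assms(2) by (rule finite_subset) simp
  have "\<not> T \<subseteq> {c \<in> {..<b}. \<not> Q c}"
  proof
    assume "T \<subseteq> {c \<in> {..<b}. \<not> Q c}"
    then have "card T \<le> card {c \<in> {..<b}. \<not> Q c}"
      by (rule card_mono[rotated]) simp
    with assms(1,3) show False
      by linarith
  qed
  then obtain c where "c \<in> T" "Q c"
    using assms(2) by blast
  with fin show ?thesis
    by (rule that[rotated 2])
qed

text \<open>
  If fewer than \<open>r\<close> values are far from \<open>t\<close>, every index set of size \<open>r\<close> contains a value close to \<open>t\<close>. This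
  bounds every maximum in the definition of \<open>lower_stat\<close> from below and every minimum in that of
  \<open>upper_stat\<close> from above.
\<close>

lemma order_stats_near:
  assumes few: "card {c \<in> {..<b}. \<bar>y c - t\<bar> > w} < r" and "r \<le> b"
  shows "t - w \<le> lower_stat r b y" "upper_stat r b y \<le> t + w"
proof -
  have few': "card {c \<in> {..<b}. \<not> \<bar>y c - t\<bar> \<le> w} < r"
    using few by (simp add: not_le)
  have "t - w \<le> Max (y ` T)" if T: "T \<subseteq> {..<b}" "card T = r" for T
  proof -
    obtain c where "c \<in> T" "\<bar>y c - t\<bar> \<le> w" "finite T"
      using rank_set_meets_majority[OF few' T] by blast
    then have "t - w \<le> y c" "y c \<le> Max (y ` T)"
      by auto
    then show ?thesis
      by (rule order_trans)
  qed
  then show "t - w \<le> lower_stat r b y"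
    unfolding lower_stat_def using finite_rank_sets rank_sets_nonempty[OF \<open>r \<le> b\<close>]
    by (subst Min_ge_iff) auto
  have "Min (y ` T) \<le> t + w" if T: "T \<subseteq> {..<b}" "card T = r" for T
  proof -
    obtain c where "c \<in> T" "\<bar>y c - t\<bar> \<le> w" "finite T"
      using rank_set_meets_majority[OF few' T] by blast
    then have "Min (y ` T) \<le> y c" "y c \<le> t + w"
      by auto
    then show ?thesis
      by (rule order_trans)
  qed
  then show "upper_stat r b y \<le> t + w"
    unfolding upper_stat_def using finite_rank_sets rank_sets_nonempty[OF \<open>r \<le> b\<close>]
    by (subst Max_le_iff) auto
qed

section \<open>Confidence intervals from block means\<close>

text \<open>
  The rank \<open>b div 4 + 1\<close> is the least integer above \<open>b / 4\<close>: a count below it is at most \<open>b / 4\<close>, and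
  a count of at least this rank exceeds \<open>b / 4\<close>. It is at most \<open>b\<close> for all \<open>b \<ge> 1\<close>.
\<close>

definition quartile_lo :: "nat \<Rightarrow> nat \<Rightarrow> (nat \<Rightarrow> real) \<Rightarrow> real" where
  "quartile_lo n b x = lower_stat (b div 4 + 1) b (\<lambda>c. block_mean (n div b) c x)"

definition quartile_hi :: "nat \<Rightarrow> nat \<Rightarrow> (nat \<Rightarrow> real) \<Rightarrow> real" where
  "quartile_hi n b x = upper_stat (b div 4 + 1) b (\<lambda>c. block_mean (n div b) c x)"

lemma measurable_quartiles:
  shows "quartile_lo n b \<in> borel_measurable (\<Pi>\<^sub>M i\<in>{..<n}. borel)"
    and "quartile_hi n b \<in> borel_measurable (\<Pi>\<^sub>M i\<in>{..<n}. borel)"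
proof -
  have mean: "block_mean (n div b) c \<in> borel_measurable (\<Pi>\<^sub>M i\<in>{..<n}. borel)"
    if "c \<in> T" "T \<subseteq> {..<b}" for c T
    using that by (intro measurable_block_mean[of c b]) auto
  have fin: "finite T" if "T \<subseteq> {..<b}" for T
    using that finite_subset by blast
  show "quartile_lo n b \<in> borel_measurable (\<Pi>\<^sub>M i\<in>{..<n}. borel)"
    unfolding quartile_lo_def lower_stat_def
    by (rule borel_measurable_Min[OF finite_rank_sets], rule borel_measurable_Max)
      (use fin mean in blast)+
  show "quartile_hi n b \<in> borel_measurable (\<Pi>\<^sub>M i\<in>{..<n}. borel)"
    unfolding quartile_hi_def upper_stat_def
    by (rule borel_measurable_Max[OF finite_rank_sets], rule borel_measurable_Min)
      (use fin mean in blast)+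
qed

text \<open>The right-hand side is \<open>b / 4\<close>, in the form in which Hoeffding's inequality is applied.\<close>

lemma below_rank_imp:
  assumes "card A < b div 4 + 1"
  shows "real (card A) \<le> (1 / 3 - 1 / 12) * real b"
proof -
  have "4 * card A \<le> b"
    using assms by linarith
  then have "real (4 * card A) \<le> real b"
    by (simp only: of_nat_le_iff)
  then show ?thesis
    by simp
qed

text \<open>
  If \<open>\<mu>\<close> lies outside the quartile interval, at most \<open>b / 4\<close> block means are \<open>\<le> \<mu>\<close> or at most \<open>b / 4\<close> are
  \<open>\<ge> \<mu>\<close>. Since \<open>b * k \<le> n\<close>, the blocks have length at least \<open>k\<close>, so by regularity at least \<open>b / 3\<close> block means are
  expected on either side. The deviation \<open>b / 12\<close> gives the exponent \<open>2 b / 12\<^sup>2 = b / 72\<close>.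
\<close>

lemma miss_prob:
  assumes P: "P \<in> P2_reg k" and k: "k > 0" and b: "b > 0" and bk: "b * k \<le> n"
  shows "measure (iid_sample n P) {x \<in> space (iid_sample n P).
      \<not> (quartile_lo n b x \<le> mean P \<and> mean P \<le> quartile_hi n b x)} \<le> 2 * exp (- real b / 72)"
proof -
  let ?m = "n div b" and ?\<mu> = "mean P" and ?M = "iid_sample n P"
  have P2: "P \<in> P2" and reg: "\<And>j. k \<le> j \<Longrightarrow> p_plus P j \<ge> 1 / 3 \<and> p_minus P j \<ge> 1 / 3"
    using P by (auto simp: P2_reg_def)
  note RD = P2_integrable(1)[OF P2]
  have bm: "b * ?m \<le> n"
    by simp
  have mk: "k \<le> ?m"
    using b bk by (simp add: less_eq_div_iff_mult_less_eq mult.commute)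
  interpret prob_space ?M
    using RD by (rule prob_space_iid_sample)
  note indep = block_means_indep[OF RD bm]
  have tail: "prob {x \<in> space ?M. card {c \<in> {..<b}. block_mean ?m c x \<in> S} < b div 4 + 1}
      \<le> exp (- real b / 72)" 
    if S: "S \<in> sets borel" and p: "1 / 3 \<le> measure (iid_sample ?m P)
        {x \<in> space (iid_sample ?m P). block_mean ?m 0 x \<in> S}" for S
  proof -
    have [measurable]: "block_mean ?m c \<in> borel_measurable ?M" if "c < b" for c
      using measurable_iid_sample[OF RD measurable_block_mean[OF that bm]] .
    note S[measurable]
    have "prob {x \<in> space ?M. card {c \<in> {..<b}. block_mean ?m c x \<in> S} < b div 4 + 1}
      \<le> prob {x \<in> space ?M. real (card {c \<in> {..<b}. block_mean ?m c x \<in> S}) \<le> (1 / 3 - 1 / 12) * real b}"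
    proof (rule finite_measure_mono)
      show "{x \<in> space ?M. real (card {c \<in> {..<b}. block_mean ?m c x \<in> S}) \<le> (1 / 3 - 1 / 12) * real b}
        \<in> events"
        by measurable
    qed (use below_rank_imp in blast)
    also have "\<dots> \<le> exp (- 2 * (1 / 12)\<^sup>2 * real b)"
    proof (intro few_hits_prob[OF indep] b S)
      fix c assume "c < b"
      show "1 / 3 \<le> prob {x \<in> space ?M. block_mean ?m c x \<in> S}"
        using p unfolding block_mean_prob[OF RD \<open>c < b\<close> bm S] .
    qed simp
    finally show ?thesis
      by (simp add: power2_eq_square)
  qed
  have sum_iff: "block_mean ?m 0 x \<le> ?\<mu> \<longleftrightarrow> (\<Sum>i<?m. x i) \<le> real ?m * ?\<mu>"
    "?\<mu> \<le> block_mean ?m 0 x \<longleftrightarrow> real ?m * ?\<mu> \<le> (\<Sum>i<?m. x i)" if "?m > 0" for x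
    using that by (auto simp: block_mean_def field_simps)
  show ?thesis
  proof (cases "?m = 0")
    case True
    with mk k show ?thesis by simp
  next
    case False
    let ?few = "\<lambda>S. {x \<in> space ?M. card {c \<in> {..<b}. block_mean ?m c x \<in> S} < b div 4 + 1}"
    have few_sets: "?few S \<in> events" if [measurable]: "S \<in> sets borel" for S
    proof -
      have [measurable]: "block_mean ?m c \<in> borel_measurable ?M" if "c < b" for c
        using measurable_iid_sample[OF RD measurable_block_mean[OF that bm]] .
      show ?thesis by measurable
    qed
    have "{x \<in> space ?M. \<not> (quartile_lo n b x \<le> ?\<mu> \<and> ?\<mu> \<le> quartile_hi n b x)}
        \<subseteq> ?few {..?\<mu>} \<union> ?few {?\<mu>..}"
    proof
      fix z assume z: "z \<in> {x \<in> space ?M. \<not> (quartile_lo n b x \<le> ?\<mu> \<and> ?\<mu> \<le> quartile_hi n b x)}"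
      show "z \<in> ?few {..?\<mu>} \<union> ?few {?\<mu>..}"
      proof (rule ccontr)
        assume "z \<notin> ?few {..?\<mu>} \<union> ?few {?\<mu>..}"
        then have many: "b div 4 + 1 \<le> card {c \<in> {..<b}. block_mean ?m c z \<le> ?\<mu>}"
          "b div 4 + 1 \<le> card {c \<in> {..<b}. ?\<mu> \<le> block_mean ?m c z}"
          using z by (simp_all add: not_less)
        have "quartile_lo n b z \<le> ?\<mu>"
          unfolding quartile_lo_def by (rule lower_stat_le[OF _ many(1)]) simp
        moreover have "?\<mu> \<le> quartile_hi n b z"
          unfolding quartile_hi_def by (rule upper_stat_ge[OF _ many(2)]) simp
        ultimately show False
          using z by simp
      qed
    qed
    then have "prob {x \<in> space ?M. \<not> (quartile_lo n b x \<le> ?\<mu> \<and> ?\<mu> \<le> quartile_hi n b x)}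
        \<le> prob (?few {..?\<mu>} \<union> ?few {?\<mu>..})"
      by (rule finite_measure_mono) (intro sets.Un few_sets; simp)
    also have "\<dots> \<le> prob (?few {..?\<mu>}) + prob (?few {?\<mu>..})"
      by (rule measure_Un_le; intro few_sets; simp)
    also have "\<dots> \<le> exp (- real b / 72) + exp (- real b / 72)"
    proof (intro add_mono tail)
      have m: "?m > 0"
        using False by simp
      show "1 / 3 \<le> measure (iid_sample ?m P)
          {x \<in> space (iid_sample ?m P). block_mean ?m 0 x \<in> {..?\<mu>}}"
        using reg[OF mk] unfolding atMost_iff sum_iff[OF m] p_minus_def by (rule conjunct2)
      show "1 / 3 \<le> measure (iid_sample ?m P)
          {x \<in> space (iid_sample ?m P). block_mean ?m 0 x \<in> {?\<mu>..}}"
        using reg[OF mk] unfolding atLeast_iff sum_iff[OF m] p_plus_def by (rule conjunct1)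
    qed simp_all
    finally show ?thesis by simp
  qed
qed

text \<open>
  A quartile farther than \<open>w\<close> from the mean needs more than \<open>b / 4\<close> block means farther than \<open>w\<close>
  away. The constant \<open>6\<close> in \<open>w\<close> makes at most \<open>b / 6\<close> of them expected, so that the deviation is
  again \<open>b / 12\<close>.
\<close>

lemma wide_prob:
  assumes P: "P \<in> P2" and b: "b > 0" and bn: "b \<le> n"
  defines "w \<equiv> sqrt (6 / real (n div b)) * std_dev P"
  shows "measure (iid_sample n P) {x \<in> space (iid_sample n P).
      \<not> (mean P - w \<le> quartile_lo n b x \<and> quartile_hi n b x \<le> mean P + w)} \<le> exp (- real b / 72)"
proof -
  let ?m = "n div b" and ?M = "iid_sample n P"
  let ?S = "{y. \<bar>y - mean P\<bar> > w}"
  note RD = P2_integrable(1)[OF P]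
  have bm: "b * ?m \<le> n"
    by simp
  have m: "?m > 0"
    using b bn by (simp add: div_greater_zero_iff)
  interpret prob_space ?M
    using RD by (rule prob_space_iid_sample)
  have S [measurable]: "?S \<in> sets borel"
    by measurable
  have [measurable]: "block_mean ?m c \<in> borel_measurable ?M" if "c < b" for c
    using measurable_iid_sample[OF RD measurable_block_mean[OF that bm]] .
  have dev: "prob {x \<in> space ?M. block_mean ?m c x \<in> ?S} \<le> 1 / 6" if "c < b" for c
    using sample_mean_deviation[OF P m, of 6]
    unfolding block_mean_prob[OF RD that bm S] by (simp add: w_def)
  have "prob {x \<in> space ?M. \<not> (mean P - w \<le> quartile_lo n b x \<and> quartile_hi n b x \<le> mean P + w)}
      \<le> prob {x \<in> space ?M. real (card {c \<in> {..<b}. block_mean ?m c x \<in> ?S}) \<ge> (1 / 6 + 1 / 12) * real b}"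
  proof (rule finite_measure_mono)
    have "mean P - w \<le> quartile_lo n b x \<and> quartile_hi n b x \<le> mean P + w"
      if "\<not> real (card {c \<in> {..<b}. block_mean ?m c x \<in> ?S}) \<ge> (1 / 6 + 1 / 12) * real b" for x
    proof -
      have "card {c \<in> {..<b}. \<bar>block_mean ?m c x - mean P\<bar> > w} < b div 4 + 1"
        using that by simp
      moreover have "b div 4 + 1 \<le> b"
        using b by linarith
      ultimately show ?thesis
        unfolding quartile_lo_def quartile_hi_def by (intro conjI order_stats_near)
    qed
    then show "{x \<in> space ?M. \<not> (mean P - w \<le> quartile_lo n b x \<and> quartile_hi n b x \<le> mean P + w)}
      \<subseteq> {x \<in> space ?M. real (card {c \<in> {..<b}. block_mean ?m c x \<in> ?S}) \<ge> (1 / 6 + 1 / 12) * real b}"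
      by blast
  qed measurable
  also have "\<dots> \<le> exp (- 2 * (1 / 12)\<^sup>2 * real b)"
    using b dev by (intro many_hits_prob[OF block_means_indep[OF RD bm]] S) auto
  finally show ?thesis
    by (simp add: power2_eq_square)
qed

section \<open>Selecting one point for all confidence levels\<close>

text \<open>
  The interval \<open>{Max (lo ` {b..B})..Min (hi ` {b..B})}\<close> is the intersection of the intervals with
  indices in \<open>{b..B}\<close>. Its left endpoint does not drop as \<open>b\<close> decreases, so the maximum over all \<open>b\<close> with
  nonempty intersection is the left endpoint for the smallest such \<open>b\<close>. The default
  value \<open>lo B\<close> for empty intersections is below all left endpoints, so it does not change this maximum as long as some intersection
  is nonempty.
\<close>

definition lepski_select :: "(nat \<Rightarrow> real) \<Rightarrow> (nat \<Rightarrow> real) \<Rightarrow> nat \<Rightarrow> real" where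
  "lepski_select lo hi B = Max ((\<lambda>b. if Max (lo ` {b..B}) \<le> Min (hi ` {b..B})
      then Max (lo ` {b..B}) else lo B) ` {1..B})"

text \<open>
  The common point \<open>t\<close> makes the intersection from \<open>b\<close> on nonempty, so the smallest index with
  nonempty intersection is at most \<open>b\<close> and its intersection is part of the interval with index \<open>b\<close>. Hence the
  selected point is in this interval, although \<open>b\<close> is unknown to the selection.
\<close>

lemma lepski_select_in_interval:
  assumes b: "b \<in> {1..B}" and cover: "\<And>j. j \<in> {b..B} \<Longrightarrow> lo j \<le> t \<and> t \<le> hi j"
  shows "lo b \<le> lepski_select lo hi B" "lepski_select lo hi B \<le> hi b"
proof -
  let ?A = "\<lambda>b. Max (lo ` {b..B})" and ?D = "\<lambda>b. Min (hi ` {b..B})"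
  have "?A b \<le> t" "t \<le> ?D b"
    using b cover by (auto simp: Max_le_iff Min_ge_iff)
  then have feasible: "?A b \<le> ?D b"
    by simp
  have A_ge: "lo j \<le> ?A i" and D_le: "?D i \<le> hi j" if "j \<in> {i..B}" for i j
    using that by (auto intro: Max_ge Min_le)
  have "lo b \<le> ?A b"
    using b by (intro A_ge) auto
  also have "\<dots> \<le> lepski_select lo hi B"
    unfolding lepski_select_def by (rule Max_ge) (use b feasible in \<open>auto intro!: image_eqI[of _ _ b]\<close>)
  finally show "lo b \<le> lepski_select lo hi B" .
  \<comment> \<open>For \<open>i \<le> b\<close> the nonempty intersection from \<open>i\<close> on is contained in interval \<open>b\<close>; in all other
    cases the value is at most the left endpoint of the intersection from \<open>b\<close> on.\<close>
  have "(if ?A i \<le> ?D i then ?A i else lo B) \<le> hi b" if i: "i \<in> {1..B}" for i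
  proof (cases "?A i \<le> ?D i \<and> i \<le> b")
    case True
    then show ?thesis
      using D_le[of b i] b by auto
  next
    case False
    have "?A b \<le> hi b"
      using feasible D_le[of b b] b by auto
    moreover have "?A i \<le> ?A b" if "b \<le> i"
      using that i by (intro Max_mono) auto
    moreover have "lo B \<le> ?A b"
      using b by (intro A_ge) auto
    ultimately show ?thesis
      using False by auto
  qed
  then have bound: "v \<le> hi b" if "v \<in> (\<lambda>i. if ?A i \<le> ?D i then ?A i else lo B) ` {1..B}" for v
    using that by blast
  show "lepski_select lo hi B \<le> hi b"
    unfolding lepski_select_def
  proof (rule Max.boundedI)
    show "(\<lambda>i. if ?A i \<le> ?D i then ?A i else lo B) ` {1..B} \<noteq> {}"
      using b unfolding image_is_empty by auto
  qed (use bound in blast)+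
qed

lemma measurable_lepski_select:
  assumes [measurable]: "\<And>b. lo b \<in> borel_measurable M" "\<And>b. hi b \<in> borel_measurable M"
  shows "(\<lambda>x. lepski_select (\<lambda>b. lo b x) (\<lambda>b. hi b x) B) \<in> borel_measurable M"
proof -
  have [measurable]: "(\<lambda>x. Max ((\<lambda>j. lo j x) ` {b..B})) \<in> borel_measurable M"
    "(\<lambda>x. Min ((\<lambda>j. hi j x) ` {b..B})) \<in> borel_measurable M" for b
    by (intro borel_measurable_Max borel_measurable_Min; simp)+
  show ?thesis
    unfolding lepski_select_def by (intro borel_measurable_Max) (simp, measurable)
qed

section \<open>Numerical bounds\<close>

text \<open>The ratio \<open>q = exp (-1/72)\<close> satisfies \<open>1/q \<ge> 1 + 1/72 = 73/72\<close>, whence \<open>1 / (1 - q) \<le> 73\<close>.\<close>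

lemma geometric_tail:
  "(\<Sum>j\<in>{b..B}. exp (- real j / 72)) \<le> 73 * exp (- real b / 72)"
proof -
  define q :: real where "q = exp (- 1 / 72)"
  have pow: "exp (- real j / 72) = q ^ j" for j
    unfolding q_def by (simp flip: exp_of_nat_mult)
  have "q * exp (1 / 72) = 1"
    unfolding q_def by (simp flip: exp_add)
  moreover have "q * (1 + 1 / 72) \<le> q * exp (1 / 72)"
    using exp_ge_add_one_self[of "1 / 72"] by (intro mult_left_mono) (auto simp: q_def)
  ultimately have q: "1 \<le> 73 * (1 - q)"
    by simp
  have "(1 - q) * (\<Sum>j\<in>{b..B}. q ^ j) \<le> q ^ b"
  proof (cases "b \<le> B")
    case True
    then show ?thesis
      using sum_gp_multiplied[of b B q] by (simp add: q_def)
  qed (simp add: q_def)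
  then have "73 * (1 - q) * (\<Sum>j\<in>{b..B}. q ^ j) \<le> 73 * q ^ b"
    unfolding mult.assoc by (intro mult_left_mono) auto
  moreover have "1 * (\<Sum>j\<in>{b..B}. q ^ j) \<le> 73 * (1 - q) * (\<Sum>j\<in>{b..B}. q ^ j)"
    using q by (intro mult_right_mono sum_nonneg) (auto simp: q_def)
  ultimately show ?thesis
    unfolding pow by simp
qed

text \<open>
  The factor \<open>147 = 2 * 73 + 1\<close> collects the two sides of all missed intervals and one interval that is too wide.
  The additive constant in the number of blocks absorbs it: \<open>(124 * (3 + ln 4) - 1) / 72 > 6\<close>,
  and \<open>exp 6 \<ge> (5/2)^6 > 147\<close>.
\<close>

lemma exp_failure_bound:
  assumes "real b > 124 * (x + 3 + ln 4) - 1" "x \<ge> 0"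
  shows "147 * exp (- real b / 72) \<le> exp (- x)"
proof -
  have "exp 1 \<le> (4::real)"
    using exp_le by simp
  then have ln4: "1 \<le> ln (4::real)"
    by (simp add: ln_ge_iff)
  have "5 / 2 \<le> exp (1::real)"
    using exp_lower_Taylor_quadratic[of "1::real"] by simp
  then have "(5 / 2) ^ 6 \<le> exp (1::real) ^ 6"
    by (intro power_mono) auto
  then have "147 \<le> exp (6::real)"
    by (simp flip: exp_of_nat_mult add: power_divide)
  then have "147 * exp (- real b / 72) \<le> exp 6 * exp (- real b / 72)"
    by simp
  also have "\<dots> \<le> exp (- x)"
    using assms ln4 by (simp flip: exp_add)
  finally show ?thesis .
qed

text \<open>
  Rounding loses at most a factor \<open>2\<close> in the block length, \<open>n div b \<ge> n / (2 * b)\<close>, so the squared half-width is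
  at most the multiple \<open>12 * b / n \<le> 12 * 124 * 5 * (1 + x) / n = 7440 * (1 + x) / n\<close>
  of the variance \<open>s\<^sup>2\<close>. Here \<open>5\<close> bounds \<open>3 + ln 4\<close>, and \<open>7440 \<le> L\<^sup>2\<close> by a wide margin.
\<close>

lemma width_bound:
  assumes "b > 0" "b \<le> n" "real b \<le> 124 * (x + 3 + ln 4)" "x \<ge> 0" "s \<ge> 0"
  defines "L \<equiv> 4 * sqrt (2 * (1 + 2 * ln 2) * (1 + 62 * ln 3)) * exp (5 / 2)"
  shows "sqrt (6 / real (n div b)) * s \<le> L * s * sqrt ((1 + x) / real n)"
proof -
  let ?m = "n div b"
  have m: "?m \<ge> 1"
    using assms(1,2) by (simp add: less_eq_div_iff_mult_less_eq)
  have "n < b * (?m + 1)"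
    using assms(1) by (metis Suc_eq_plus1 dividend_less_times_div mult_Suc_right add.commute)
  also have "\<dots> \<le> b * (2 * ?m)"
    using m by (intro mult_left_mono) auto
  finally have "real n \<le> real b * (2 * real ?m)"
    by (metis of_nat_less_iff of_nat_mult of_nat_numeral less_imp_le)
  then have "6 / real ?m \<le> 12 * real b / real n"
    using m assms(1,2) by (simp add: field_simps)
  also have "\<dots> \<le> 7440 * (1 + x) / real n"
  proof -
    have "ln (4::real) \<le> 2"
      using ln_le_minus_one[of "2::real"] ln_mult[of 2 "2::real"] by simp
    then have "12 * real b \<le> 7440 * (1 + x)"
      using assms(3,4) by simp
    then show ?thesis
      by (intro divide_right_mono) auto
  qed
  also have "\<dots> \<le> L\<^sup>2 * ((1 + x) / real n)"
  proof -
    have "ln 3 \<ge> (1::real)"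
      using exp_le by (simp add: ln_ge_iff)
    then have "63 \<le> (1 + 2 * ln 2) * (1 + 62 * ln (3::real))"
      using mult_mono[of 1 "1 + 2 * ln (2::real)" 63 "1 + 62 * ln (3::real)"] by simp
    moreover have "exp 5 \<ge> (5::real)"
      using exp_ge_add_one_self[of "5::real"] by simp
    ultimately have "32 * 63 * 5 \<le> 32 * ((1 + 2 * ln 2) * (1 + 62 * ln (3::real))) * exp 5"
      by (intro mult_mono) auto
    moreover have "L\<^sup>2 = 32 * ((1 + 2 * ln 2) * (1 + 62 * ln 3)) * exp 5"
      using \<open>ln 3 \<ge> 1\<close> unfolding L_def
      by (simp add: power_mult_distrib exp_double[symmetric])
    ultimately have "7440 \<le> L\<^sup>2"
      by simp
    then have "7440 * ((1 + x) / real n) \<le> L\<^sup>2 * ((1 + x) / real n)"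
      using assms(4) by (intro mult_right_mono) auto
    then show ?thesis by simp
  qed
  finally have "sqrt (6 / real ?m) \<le> sqrt (L\<^sup>2 * ((1 + x) / real n))"
    by (rule real_sqrt_le_mono)
  also have "\<dots> = L * sqrt ((1 + x) / real n)"
  proof -
    have "ln 3 \<ge> (0::real)" "ln 2 \<ge> (0::real)"
      by auto
    then have "L \<ge> 0"
      unfolding L_def by (intro mult_nonneg_nonneg) auto
    then show ?thesis
      by (subst real_sqrt_mult) simp
  qed
  finally show ?thesis
    using mult_right_mono[OF _ assms(5), of "sqrt (6 / real ?m)" "L * sqrt ((1 + x) / real n)"]
    by (simp add: mult_ac)
qed

theorem theorem3p3:
  fixes n k :: nat
  assumes "n > 0" and "k > 0"
    and "real n \<ge> (3 + ln 4) * (124 * real k)"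
  defines "\<delta>min \<equiv> 4 * exp (3 - real n / (124 * real k))"
    and "L \<equiv> 4 * sqrt (2 * (1 + 2 * ln 2) * (1 + 62 * ln 3)) * exp (5 / 2)"
  shows "\<exists>E. multiple_delta_subgaussian_estimator L (P2_reg k) n \<delta>min E"
proof -
  define B where "B = n div k"
  define E where "E x = lepski_select (\<lambda>b. quartile_lo n b x) (\<lambda>b. quartile_hi n b x) B" for x
  have E: "E \<in> borel_measurable (\<Pi>\<^sub>M i\<in>{..<n}. borel)"
    unfolding E_def by (intro measurable_lepski_select measurable_quartiles)
  have "measure (iid_sample n P) {x \<in> space (iid_sample n P).
      \<bar>E x - mean P\<bar> > L * std_dev P * sqrt ((1 + ln (1 / \<delta>)) / real n)} \<le> \<delta>"
    if \<delta>: "\<delta> \<in> {\<delta>min..<1}" and P: "P \<in> P2_reg k" for \<delta> P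
  proof -
    have P2: "P \<in> P2"
      using P by (simp add: P2_reg_def)
    note RD = P2_integrable(1)[OF P2]
    interpret prob_space "iid_sample n P"
      using RD by (rule prob_space_iid_sample)
    define x where "x = ln (1 / \<delta>)"
    have "\<delta>min > 0"
      by (simp add: \<delta>min_def)
    then have \<delta>_pos: "\<delta> > 0" and \<delta>_exp: "\<delta> = exp (- x)" and x: "x \<ge> 0"
      using \<delta> by (auto simp: x_def ln_div)
    have "ln \<delta>min \<le> ln \<delta>"
      using \<delta> \<open>\<delta>min > 0\<close> by (intro ln_mono) auto
    then have x_le: "124 * (x + 3 + ln 4) \<le> real n / real k"
      using \<delta>_pos \<open>k > 0\<close> by (simp add: x_def \<delta>min_def ln_div ln_mult field_simps)
    define b where "b = nat \<lfloor>124 * (x + 3 + ln 4)\<rfloor>"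
    have y: "124 * (x + 3 + ln 4) \<ge> 1"
      using x ln_ge_zero[of "4::real"] by simp
    have b_lower: "real b > 124 * (x + 3 + ln 4) - 1" and b_upper: "real b \<le> 124 * (x + 3 + ln 4)"
      and b: "b \<ge> 1"
      using y unfolding b_def by linarith+
    have bB: "b \<in> {1..B}"
    proof -
      have "real b \<le> real n / real k"
        using b_upper x_le by linarith
      then have "real b * real k \<le> real n"
        using \<open>k > 0\<close> by (simp add: pos_le_divide_eq)
      then have "b * k \<le> n"
        by (metis of_nat_le_iff of_nat_mult)
      then show ?thesis
        using b \<open>k > 0\<close> by (simp add: B_def less_eq_div_iff_mult_less_eq)
    qed
    have jk: "j * k \<le> n" "j > 0" if "j \<in> {b..B}" for j
      using that b \<open>k > 0\<close> by (auto simp: B_def less_eq_div_iff_mult_less_eq)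
    have bn: "b \<le> n"
    proof -
      have "b * 1 \<le> b * k"
        using \<open>k > 0\<close> by (intro mult_le_mono2) simp
      also have "\<dots> \<le> n"
        using bB by (intro jk) simp
      finally show ?thesis
        by simp
    qed
    define w where "w = sqrt (6 / real (n div b)) * std_dev P"
    have w: "w \<le> L * std_dev P * sqrt ((1 + ln (1 / \<delta>)) / real n)"
    proof -
      have "std_dev P \<ge> 0"
        unfolding std_dev_def variance_of_def by (auto intro: integral_nonneg_AE)
      then show ?thesis
        unfolding w_def L_def x_def[symmetric] using b bn b_upper x by (intro width_bound) auto
    qed
    let ?miss = "\<lambda>j. {x \<in> space (iid_sample n P).
      \<not> (quartile_lo n j x \<le> mean P \<and> mean P \<le> quartile_hi n j x)}"
    let ?wide = "{x \<in> space (iid_sample n P).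
      \<not> (mean P - w \<le> quartile_lo n b x \<and> quartile_hi n b x \<le> mean P + w)}"
    have [measurable]: "quartile_lo n j \<in> borel_measurable (iid_sample n P)"
      "quartile_hi n j \<in> borel_measurable (iid_sample n P)" for j
      by (intro measurable_iid_sample[OF RD] measurable_quartiles)+
    have "{x \<in> space (iid_sample n P). \<bar>E x - mean P\<bar> > L * std_dev P * sqrt ((1 + ln (1 / \<delta>)) / real n)}
        \<subseteq> ?wide \<union> (\<Union>j\<in>{b..B}. ?miss j)"
    proof
      fix z assume z: "z \<in> {x \<in> space (iid_sample n P).
        \<bar>E x - mean P\<bar> > L * std_dev P * sqrt ((1 + ln (1 / \<delta>)) / real n)}"
      show "z \<in> ?wide \<union> (\<Union>j\<in>{b..B}. ?miss j)"
      proof (rule ccontr)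
        assume "z \<notin> ?wide \<union> (\<Union>j\<in>{b..B}. ?miss j)"
        then have near: "mean P - w \<le> quartile_lo n b z" "quartile_hi n b z \<le> mean P + w"
          and cover: "\<And>j. j \<in> {b..B} \<Longrightarrow> quartile_lo n j z \<le> mean P \<and> mean P \<le> quartile_hi n j z"
          using z by auto
        have "\<bar>E z - mean P\<bar> \<le> w"
          using near lepski_select_in_interval[OF bB, of "\<lambda>b. quartile_lo n b z" "mean P"
              "\<lambda>b. quartile_hi n b z"] cover unfolding E_def by fastforce
        with z w show False by simp
      qed
    qed
    then have "prob {x \<in> space (iid_sample n P).
        \<bar>E x - mean P\<bar> > L * std_dev P * sqrt ((1 + ln (1 / \<delta>)) / real n)}
      \<le> prob (?wide \<union> (\<Union>j\<in>{b..B}. ?miss j))"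
      by (rule finite_measure_mono) measurable
    also have "\<dots> \<le> prob ?wide + prob (\<Union>j\<in>{b..B}. ?miss j)"
      by (rule measure_Un_le) measurable
    also have "\<dots> \<le> prob ?wide + (\<Sum>j\<in>{b..B}. prob (?miss j))"
      by (intro add_left_mono finite_measure_subadditive_finite) auto
    also have "\<dots> \<le> exp (- real b / 72) + (\<Sum>j\<in>{b..B}. 2 * exp (- real j / 72))"
      using b bn jk unfolding w_def
      by (intro add_mono sum_mono wide_prob[OF P2] miss_prob[OF P \<open>k > 0\<close>]) auto
    also have "\<dots> \<le> 147 * exp (- real b / 72)"
      using geometric_tail[of b B] by (simp flip: sum_distrib_left)
    also have "\<dots> \<le> \<delta>"
      unfolding \<delta>_exp by (rule exp_failure_bound[OF b_lower x])
    finally show ?thesis .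
  qed
  then have "multiple_delta_subgaussian_estimator L (P2_reg k) n \<delta>min E"
    unfolding multiple_delta_subgaussian_estimator_def using E by blast
  then show ?thesis
    by (intro exI[of _ E])
qed

end
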